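(* Let $\mathit{Prog}$ be any CLP program (in the setting described in the context, containing the nullary predicate $\mathtt{unsafe}$ and no two identical predicate symbols with different arities). Then the cFAR algorithm applied to $\mathit{Prog}$ terminates and produces a CLP program $\mathit{Prog}|_E$, where $E$ is the erasure it computes, such that $\mathtt{unsafe} \in \mathcal{M}(\mathit{Prog})$ if and only if $\mathtt{unsafe} \in \mathcal{M}(\mathit{Prog}|_E)$.
   Context: A CLP program is a finite set of clauses $\mathtt{H \,\text{:-}\, c, G}$, where $\mathtt{H}$ is an atom, $\mathtt{G}$ a conjunction of atoms and $\mathtt{c}$ a constraint of the form $\mathtt{c_1}\wedge\dots\wedge\mathtt{c_h}$ ($h\ge 0$) of atomic constraints in the theory $\mathcal{A}$ of linear integer arithmetic with integer arrays. $\mathcal{M}(P)$ denotes the least model of $P$; $\mathtt{unsafe}$ is a nullary predicate. An erasure is a set of pairs $(\mathtt{p},k)$ with $\mathtt{p}$ a predicate symbol of arity $n$ and $1\le k\le n$. For an atom $\mathtt{A}$ with predicate $\mathtt{p}$, the erased atom $\mathtt{A}|_E$ is obtained by dropping every argument at a position $k$ with $(\mathtt{p},k)\in E$; $C|_E$ and $\mathit{Prog}|_E$ are obtained by replacing every atom $\mathtt{A}$ by $\mathtt{A}|_E$. Given variables $\mathtt{X},\mathtt{Y}$ and a constraint $\mathtt{c}=\mathtt{c_1}\wedge\dots\wedge\mathtt{c_h}$, $\mathtt{X}$ is constrained to $\mathtt{Y}$ in $\mathtt{c}$ if there is $j$ such that either (i) $\{\mathtt{X},\mathtt{Y}\}\subseteq\mathit{vars}(\mathtt{c_j})$,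 or (ii) there is a variable $\mathtt{Z}$ with $\{\mathtt{X},\mathtt{Z}\}\subseteq\mathit{vars}(\mathtt{c_j})$ and $\mathtt{Z}$ constrained to $\mathtt{Y}$ in $\mathtt{c}$. An erasure $E$ is safe for $\mathit{Prog}$ if for every $(\mathtt{p},k)\in E$ and every clause $\mathtt{H\,\text{:-}\,c,G}$ of $\mathit{Prog}$ with $\mathtt{H}=\mathtt{p(X_1,\dots,X_n)}$ and $\mathtt{c}=\mathtt{c_1}\wedge\dots\wedge\mathtt{c_h}$: (i) $\mathtt{X_k}$ is a variable and $\mathcal{A}\models\forall \mathtt{X_k}\,\exists \mathtt{Y_1},\dots,\mathtt{Y_m}.\,\mathtt{c}$, where $\{\mathtt{Y_1},\dots,\mathtt{Y_m}\}=\mathit{vars}(\mathtt{c})\setminus\{\mathtt{X_k}\}$; (ii) $\mathtt{X_k}$ is not constrained (in $\mathtt{c}$) to any other variable occurring in $\mathtt{H}$; (iii) $\mathtt{X_k}$ is not constrained to any variable occurring in $\mathtt{G}|_E$. The cFAR (constrained FAR) algorithm: initialize $E$ to the full erasure, i.e. the set of all $(\mathtt{p},k)$ with $\mathtt{p}$ a predicate of arity $n$ occurring in $\mathit{Prog}$ and $1\le k\le n$; while $E$ contains a pair $(\mathtt{p},k)$ for which one of conditions (i)–(iii) above fails (for some clause of $\mathit{Prog}$ with head predicate $\mathtt{p}$), remove that pair from $E$; when no pair can be removed, output $\mathit{Prog}|_E$.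
   Formalization: Conditions (ii) and (iii) are strengthened, as the claim fails otherwise: X_k must occur in no other argument of H and must not occur in G|_E, even if it is absent from c. Each predicate has fixed argument sorts (integer or array). *)

theory Defs
  imports Main
begin

text \<open>
  The constraint theory: linear integer arithmetic with integer arrays. It is two-sorted;
  its standard structure interprets the integer sort as \<^typ>\<open>int\<close> and the array sort as the
  total maps \<^typ>\<open>int \<Rightarrow> int\<close>. The relational forms read(A,I,V) and write(A,I,V,B) are the
  atomic constraints V = Read A I and B = Write A I V.
\<close>

datatype var = IV nat | AV nat

datatype iterm =
    IVar nat
  | IConst int
  | Add iterm iterm
  | Scale int iterm
  | Read aterm iterm
and aterm =
    AVar nat
  | Write aterm iterm iterm

datatype tm = IT iterm | AT aterm

datatype atomic_constraint =
    IEq iterm iterm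
  | ILe iterm iterm
  | ILt iterm iterm
  | AEq aterm aterm

text \<open>A constraint is a finite conjunction of atomic constraints; the empty list is \<^emph>\<open>true\<close>.\<close>

type_synonym constraint = "atomic_constraint list"

primrec vars_iterm :: "iterm \<Rightarrow> var set" and vars_aterm :: "aterm \<Rightarrow> var set" where
  "vars_iterm (IVar n) = {IV n}"
| "vars_iterm (IConst i) = {}"
| "vars_iterm (Add s t) = vars_iterm s \<union> vars_iterm t"
| "vars_iterm (Scale i t) = vars_iterm t"
| "vars_iterm (Read a t) = vars_aterm a \<union> vars_iterm t"
| "vars_aterm (AVar n) = {AV n}"
| "vars_aterm (Write a s t) = vars_aterm a \<union> vars_iterm s \<union> vars_iterm t"

primrec vars_tm :: "tm \<Rightarrow> var set" where
  "vars_tm (IT t) = vars_iterm t"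
| "vars_tm (AT a) = vars_aterm a"

primrec vars_atomic :: "atomic_constraint \<Rightarrow> var set" where
  "vars_atomic (IEq s t) = vars_iterm s \<union> vars_iterm t"
| "vars_atomic (ILe s t) = vars_iterm s \<union> vars_iterm t"
| "vars_atomic (ILt s t) = vars_iterm s \<union> vars_iterm t"
| "vars_atomic (AEq a b) = vars_aterm a \<union> vars_aterm b"

definition vars_constraint :: "constraint \<Rightarrow> var set" where
  "vars_constraint c = (\<Union>a\<in>set c. vars_atomic a)"

primrec var_tm :: "var \<Rightarrow> tm" where
  "var_tm (IV n) = IT (IVar n)"
| "var_tm (AV n) = AT (AVar n)"

datatype val = IntV int | ArrV "int \<Rightarrow> int"

datatype valuation = Valuation (ival: "nat \<Rightarrow> int") (aval: "nat \<Rightarrow> int \<Rightarrow> int")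

primrec lookup :: "valuation \<Rightarrow> var \<Rightarrow> val" where
  "lookup \<sigma> (IV n) = IntV (ival \<sigma> n)"
| "lookup \<sigma> (AV n) = ArrV (aval \<sigma> n)"

primrec eval_iterm :: "valuation \<Rightarrow> iterm \<Rightarrow> int"
  and eval_aterm :: "valuation \<Rightarrow> aterm \<Rightarrow> int \<Rightarrow> int" where
  "eval_iterm \<sigma> (IVar n) = ival \<sigma> n"
| "eval_iterm \<sigma> (IConst i) = i"
| "eval_iterm \<sigma> (Add s t) = eval_iterm \<sigma> s + eval_iterm \<sigma> t"
| "eval_iterm \<sigma> (Scale i t) = i * eval_iterm \<sigma> t"
| "eval_iterm \<sigma> (Read a t) = eval_aterm \<sigma> a (eval_iterm \<sigma> t)"
| "eval_aterm \<sigma> (AVar n) = aval \<sigma> n"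
| "eval_aterm \<sigma> (Write a s t) = (eval_aterm \<sigma> a)(eval_iterm \<sigma> s := eval_iterm \<sigma> t)"

primrec eval_tm :: "valuation \<Rightarrow> tm \<Rightarrow> val" where
  "eval_tm \<sigma> (IT t) = IntV (eval_iterm \<sigma> t)"
| "eval_tm \<sigma> (AT a) = ArrV (eval_aterm \<sigma> a)"

primrec sat_atomic :: "valuation \<Rightarrow> atomic_constraint \<Rightarrow> bool" where
  "sat_atomic \<sigma> (IEq s t) \<longleftrightarrow> eval_iterm \<sigma> s = eval_iterm \<sigma> t"
| "sat_atomic \<sigma> (ILe s t) \<longleftrightarrow> eval_iterm \<sigma> s \<le> eval_iterm \<sigma> t"
| "sat_atomic \<sigma> (ILt s t) \<longleftrightarrow> eval_iterm \<sigma> s < eval_iterm \<sigma> t"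
| "sat_atomic \<sigma> (AEq a b) \<longleftrightarrow> eval_aterm \<sigma> a = eval_aterm \<sigma> b"

definition sat :: "valuation \<Rightarrow> constraint \<Rightarrow> bool" where
  "sat \<sigma> c \<longleftrightarrow> (\<forall>a\<in>set c. sat_atomic \<sigma> a)"

text \<open>Validity of \<open>\<forall>X. \<exists>Y\<^sub>1,\<dots>,Y\<^sub>m. c\<close> where \<open>{Y\<^sub>1,\<dots>,Y\<^sub>m} = vars(c) - {X}\<close>.\<close>

definition valid_forall_exists :: "var \<Rightarrow> constraint \<Rightarrow> bool" where
  "valid_forall_exists X c \<longleftrightarrow>
     (\<forall>\<sigma>. \<exists>\<sigma>'. (\<forall>Z. Z \<notin> vars_constraint c - {X} \<longrightarrow> lookup \<sigma>' Z = lookup \<sigma> Z) \<and> sat \<sigma>' c)"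

inductive constrained_to :: "constraint \<Rightarrow> var \<Rightarrow> var \<Rightarrow> bool" for c where
  direct: "a \<in> set c \<Longrightarrow> {X, Y} \<subseteq> vars_atomic a \<Longrightarrow> constrained_to c X Y"
| step: "a \<in> set c \<Longrightarrow> {X, Z} \<subseteq> vars_atomic a \<Longrightarrow> constrained_to c Z Y \<Longrightarrow> constrained_to c X Y"

text \<open>Atoms over terms are the atoms of programs; atoms over values are ground atoms.\<close>

datatype ('p, 't) atom = Atom (pred: 'p) (args: "'t list")

datatype 'p clause =
  Clause (head: "('p, tm) atom") (cons: constraint) (body: "('p, tm) atom list")

type_synonym 'p program = "'p clause set"

definition vars_atom :: "('p, tm) atom \<Rightarrow> var set" where
  "vars_atom A = (\<Union>t\<in>set (args A). vars_tm t)"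

definition eval_atom :: "valuation \<Rightarrow> ('p, tm) atom \<Rightarrow> ('p, val) atom" where
  "eval_atom \<sigma> A = Atom (pred A) (map (eval_tm \<sigma>) (args A))"

definition prog_atoms :: "'p program \<Rightarrow> ('p, tm) atom set" where
  "prog_atoms P = (\<Union>C\<in>P. insert (head C) (set (body C)))"

datatype sort = IntS | ArrS

primrec sort_of :: "tm \<Rightarrow> sort" where
  "sort_of (IT t) = IntS"
| "sort_of (AT a) = ArrS"

text \<open>
  As the constraint theory is two-sorted, a predicate symbol has a fixed list of argument
  sorts; in particular no predicate symbol is used with two different arities.
\<close>

definition clp_program :: "'p program \<Rightarrow> bool" where
  "clp_program P \<longleftrightarrow>
     finite P \<and> (\<exists>sig. \<forall>A\<in>prog_atoms P. map sort_of (args A) = sig (pred A))"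

definition is_model :: "('p, val) atom set \<Rightarrow> 'p program \<Rightarrow> bool" where
  "is_model I P \<longleftrightarrow>
     (\<forall>C\<in>P. \<forall>\<sigma>. sat \<sigma> (cons C) \<longrightarrow> (\<forall>A\<in>set (body C). eval_atom \<sigma> A \<in> I) \<longrightarrow>
        eval_atom \<sigma> (head C) \<in> I)"

definition least_model :: "'p program \<Rightarrow> ('p, val) atom set" where
  "least_model P = \<Inter>{I. is_model I P}"

lemma is_model_least_model: "is_model (least_model P) P"
  unfolding is_model_def least_model_def by blast

lemma least_model_least: "is_model I P \<Longrightarrow> least_model P \<subseteq> I"
  unfolding least_model_def by blast

text \<open>Argument positions in erasures are counted from 1, list positions from 0.\<close>

type_synonym 'p erasure = "('p \<times> nat) set"

definition erase_atom :: "'p erasure \<Rightarrow> ('p, 't) atom \<Rightarrow> ('p, 't) atom" where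
  "erase_atom E A = Atom (pred A) (nths (args A) {i. (pred A, Suc i) \<notin> E})"

definition erase_clause :: "'p erasure \<Rightarrow> 'p clause \<Rightarrow> 'p clause" where
  "erase_clause E C =
     Clause (erase_atom E (head C)) (cons C) (map (erase_atom E) (body C))"

definition erase_program :: "'p erasure \<Rightarrow> 'p program \<Rightarrow> 'p program" where
  "erase_program E P = erase_clause E ` P"

definition full_erasure :: "'p program \<Rightarrow> 'p erasure" where
  "full_erasure P = {(p, k). \<exists>A\<in>prog_atoms P. pred A = p \<and> 1 \<le> k \<and> k \<le> length (args A)}"

text \<open>
  Conditions (i)--(iii) for the \<open>k\<close>-th head argument \<open>X\<close> of a clause. A variable counts as
  constrained to itself even if it does not occur in the constraint, which
  \<^const>\<open>constrained_to\<close> does not cover; hence the requirements that \<open>X\<close> occurs in no other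
  argument of the head and does not occur in the erased body. Without the former,
  \<open>{p(X,X) :- true.  unsafe :- A=1, B=2, p(A,B).}\<close> and without the latter
  \<open>{q(X) :- X=2.  p(X) :- q(X).  unsafe :- A=1, p(A).}\<close> would be erased to a program in
  which \<open>unsafe\<close> becomes derivable.
\<close>

definition safe_position :: "'p erasure \<Rightarrow> 'p clause \<Rightarrow> nat \<Rightarrow> bool" where
  "safe_position E C k \<longleftrightarrow>
     (\<exists>X. args (head C) ! (k - 1) = var_tm X \<and> valid_forall_exists X (cons C) \<and>
        (\<forall>j<length (args (head C)). j \<noteq> k - 1 \<longrightarrow> X \<notin> vars_tm (args (head C) ! j)) \<and>
        (\<forall>Y\<in>vars_atom (head C). Y \<noteq> X \<longrightarrow> \<not> constrained_to (cons C) X Y) \<and>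
        (\<forall>A\<in>set (body C). \<forall>Y\<in>vars_atom (erase_atom E A).
           Y \<noteq> X \<and> \<not> constrained_to (cons C) X Y))"

text \<open>
  The algorithm is nondeterministic in the choice of the pair to be removed: one step is one
  iteration of the loop, and an output is any erasure at which a run from the full erasure stops.
\<close>

inductive cfar_step :: "'p program \<Rightarrow> 'p erasure \<Rightarrow> 'p erasure \<Rightarrow> bool" for P where
  remove: "(p, k) \<in> E \<Longrightarrow> C \<in> P \<Longrightarrow> pred (head C) = p \<Longrightarrow> \<not> safe_position E C k \<Longrightarrow>
     cfar_step P E (E - {(p, k)})"

definition cfar_terminates :: "'p program \<Rightarrow> bool" where
  "cfar_terminates P \<longleftrightarrow>
     \<not> (\<exists>f :: nat \<Rightarrow> 'p erasure. f 0 = full_erasure P \<and> (\<forall>i. cfar_step P (f i) (f (Suc i))))"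

definition cfar_output :: "'p program \<Rightarrow> 'p erasure \<Rightarrow> bool" where
  "cfar_output P E \<longleftrightarrow> (cfar_step P)\<^sup>*\<^sup>* (full_erasure P) E \<and> \<not> (\<exists>E'. cfar_step P E E')"

end

theory Submission
  imports Defs
begin

text \<open>
  If \<open>E\<close> satisfies conditions (i)--(iii), then the ground
  atoms \<^emph>\<open>all\<close> of whose well-sorted preimages under erasure lie in \<open>\<M>(P)\<close> form a model of
  the erased program. Indeed, let a clause instance be given by \<open>\<sigma>\<close>, and choose arbitrary values for
  the erased head arguments, which are variables \<open>X\<^sub>1,\<dots>,X\<^sub>r\<close>. Condition (i) yields for each
  \<open>X\<^sub>i\<close> a solution \<open>\<sigma>\<^sub>i\<close> of the constraint giving \<open>X\<^sub>i\<close> the chosen value. By (ii) the connected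
  components of the \<open>X\<^sub>i\<close> in the constraint are pairwise disjoint and avoid the remaining head
  variables, by (iii) they avoid the variables of the erased body; so the valuation that is \<open>\<sigma>\<^sub>i\<close>
  on the component of \<open>X\<^sub>i\<close> and \<open>\<sigma>\<close> elsewhere still solves the constraint and changes
  nothing but the erased arguments. The converse inclusion holds for every erasure, and
  termination because the finite erasure shrinks in each step.
\<close>

section \<open>Coincidence lemmas for terms, atomic constraints and atoms\<close>

lemma eval_iterm_cong:
    "(\<And>X. X \<in> vars_iterm t \<Longrightarrow> lookup \<sigma> X = lookup \<tau> X) \<Longrightarrow> eval_iterm \<sigma> t = eval_iterm \<tau> t"
  and eval_aterm_cong:
    "(\<And>X. X \<in> vars_aterm a \<Longrightarrow> lookup \<sigma> X = lookup \<tau> X) \<Longrightarrow> eval_aterm \<sigma> a = eval_aterm \<tau> a"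
proof (induction t and a)
  case (IVar n)
  from IVar[of "IV n"] show ?case by simp
next
  case (AVar n)
  from AVar[of "AV n"] show ?case by simp
next
  case (Add s t)
  then have "eval_iterm \<sigma> s = eval_iterm \<tau> s" "eval_iterm \<sigma> t = eval_iterm \<tau> t" by auto
  then show ?case by simp
next
  case (Read a t)
  then have "eval_aterm \<sigma> a = eval_aterm \<tau> a" "eval_iterm \<sigma> t = eval_iterm \<tau> t" by auto
  then show ?case by simp
next
  case (Write a s t)
  then have "eval_aterm \<sigma> a = eval_aterm \<tau> a" "eval_iterm \<sigma> s = eval_iterm \<tau> s"
    "eval_iterm \<sigma> t = eval_iterm \<tau> t" by auto
  then show ?case by simp
qed auto

lemma eval_tm_cong:
  assumes "\<And>X. X \<in> vars_tm t \<Longrightarrow> lookup \<sigma> X = lookup \<tau> X"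
  shows "eval_tm \<sigma> t = eval_tm \<tau> t"
  using assms eval_iterm_cong eval_aterm_cong by (cases t) (metis eval_tm.simps vars_tm.simps)+

lemma sat_atomic_cong:
  assumes "\<And>X. X \<in> vars_atomic a \<Longrightarrow> lookup \<sigma> X = lookup \<tau> X"
  shows "sat_atomic \<sigma> a = sat_atomic \<tau> a"
proof (cases a)
  case (IEq s t)
  with assms eval_iterm_cong[of s \<sigma> \<tau>] eval_iterm_cong[of t \<sigma> \<tau>] show ?thesis by simp
next
  case (ILe s t)
  with assms eval_iterm_cong[of s \<sigma> \<tau>] eval_iterm_cong[of t \<sigma> \<tau>] show ?thesis by simp
next
  case (ILt s t)
  with assms eval_iterm_cong[of s \<sigma> \<tau>] eval_iterm_cong[of t \<sigma> \<tau>] show ?thesis by simp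
next
  case (AEq s t)
  with assms eval_aterm_cong[of s \<sigma> \<tau>] eval_aterm_cong[of t \<sigma> \<tau>] show ?thesis by simp
qed

lemma eval_atom_cong:
  assumes "\<And>X. X \<in> vars_atom A \<Longrightarrow> lookup \<sigma> X = lookup \<tau> X"
  shows "eval_atom \<sigma> A = eval_atom \<tau> A"
  using assms unfolding eval_atom_def vars_atom_def by (auto intro!: eval_tm_cong)

section \<open>Sorted values and the construction of valuations\<close>

primrec sort_of_val :: "val \<Rightarrow> sort" where
  "sort_of_val (IntV i) = IntS"
| "sort_of_val (ArrV f) = ArrS"

lemma sort_of_val_eval_tm [simp]: "sort_of_val (eval_tm \<sigma> t) = sort_of t"
  by (cases t) auto

lemma eval_var_tm [simp]: "eval_tm \<sigma> (var_tm X) = lookup \<sigma> X"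
  by (cases X) auto

lemma vars_var_tm [simp]: "vars_tm (var_tm X) = {X}"
  by (cases X) auto

lemma ex_valuation_lookup:
  assumes "sort_of_val v = sort_of (var_tm X)"
  shows "\<exists>\<sigma>. lookup \<sigma> X = v"
proof (cases X)
  case (IV n)
  with assms obtain i where "v = IntV i" by (cases v) auto
  with IV have "lookup (Valuation (\<lambda>_. i) (\<lambda>_ _. 0)) X = v" by simp
  then show ?thesis by blast
next
  case (AV n)
  with assms obtain f where "v = ArrV f" by (cases v) auto
  with AV have "lookup (Valuation (\<lambda>_. 0) (\<lambda>_. f)) X = v" by simp
  then show ?thesis by blast
qed

definition glue :: "(var \<Rightarrow> valuation) \<Rightarrow> valuation" where
  "glue \<tau> = Valuation (\<lambda>n. ival (\<tau> (IV n)) n) (\<lambda>n. aval (\<tau> (AV n)) n)"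

lemma lookup_glue [simp]: "lookup (glue \<tau>) X = lookup (\<tau> X) X"
  by (cases X) (auto simp: glue_def)

section \<open>Connected components of a constraint\<close>

lemma constrained_to_trans:
  "constrained_to c X Y \<Longrightarrow> constrained_to c Y Z \<Longrightarrow> constrained_to c X Z"
  by (induction rule: constrained_to.induct) (blast intro: constrained_to.step)+

lemma constrained_to_sym: "constrained_to c X Y \<Longrightarrow> constrained_to c Y X"
proof (induction rule: constrained_to.induct)
  case (direct a X Y)
  then show ?case by (auto intro: constrained_to.direct)
next
  case (step a X Z Y)
  \<comment> \<open>The rule \<open>step\<close> extends a chain only at its front, so the reversed
    edge is appended at the end by transitivity.\<close>
  then have "constrained_to c Z X" by (auto intro: constrained_to.direct)
  with step.IH show ?case by (rule constrained_to_trans)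
qed

text \<open>The connected component of \<open>X\<close> in the graph joining variables that share an
  atomic constraint. \<open>X\<close> is inserted because \<open>constrained_to\<close> is not
  reflexive at variables outside \<open>c\<close>.\<close>

definition component :: "constraint \<Rightarrow> var \<Rightarrow> var set" where
  "component c X = insert X {Y. constrained_to c X Y}"

text \<open>This is what permits solving a constraint component by component: no atomic constraint
  straddles the border of a component.\<close>

lemma vars_atomic_subset_component:
  assumes "a \<in> set c" "Y \<in> vars_atomic a" "Y \<in> component c X"
  shows "vars_atomic a \<subseteq> component c X"
proof
  fix Z assume "Z \<in> vars_atomic a"
  with assms have "constrained_to c Y Z" by (auto intro: constrained_to.direct)
  with assms(3) show "Z \<in> component c X"
    by (auto simp: component_def intro: constrained_to_trans)
qed

lemma component_disjoint:
  assumes "X \<noteq> Y" "\<not> constrained_to c X Y"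
  shows "component c X \<inter> component c Y = {}"
  using assms by (auto simp: component_def dest: constrained_to_sym constrained_to_trans)

lemma valid_forall_existsE:
  assumes "valid_forall_exists X c" "sort_of_val v = sort_of (var_tm X)"
  obtains \<sigma> where "lookup \<sigma> X = v" "sat \<sigma> c"
proof -
  obtain \<rho> where "lookup \<rho> X = v" using ex_valuation_lookup[OF assms(2)] by blast
  \<comment> \<open>\<open>X\<close> is not among the variables that the existential witness may
    change, so the value chosen in \<rho> survives.\<close>
  with assms(1) that show thesis unfolding valid_forall_exists_def by (metis Diff_iff singletonI)
qed

text \<open>Every atomic constraint lies in one of the pairwise disjoint components or meets none of
  them, so it sees a single one of the combined solutions.\<close>

lemma sat_reassign_components:
  fixes c :: constraint
  assumes sat: "sat \<sigma> c"
    and valid: "\<And>X. X \<in> S \<Longrightarrow> valid_forall_exists X c"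
    and sort: "\<And>X. X \<in> S \<Longrightarrow> sort_of_val (v X) = sort_of (var_tm X)"
    and indep: "\<And>X Y. X \<in> S \<Longrightarrow> Y \<in> S \<Longrightarrow> X \<noteq> Y \<Longrightarrow> \<not> constrained_to c X Y"
  obtains \<sigma>' where "sat \<sigma>' c" "\<And>X. X \<in> S \<Longrightarrow> lookup \<sigma>' X = v X"
    "\<And>Y. Y \<notin> (\<Union>X\<in>S. component c X) \<Longrightarrow> lookup \<sigma>' Y = lookup \<sigma> Y"
proof -
  have "\<forall>X. \<exists>\<rho>. X \<in> S \<longrightarrow> lookup \<rho> X = v X \<and> sat \<rho> c"
    using valid sort valid_forall_existsE by metis
  then obtain \<rho> where \<rho>: "\<And>X. X \<in> S \<Longrightarrow> lookup (\<rho> X) X = v X" "\<And>X. X \<in> S \<Longrightarrow> sat (\<rho> X) c"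
    by metis
  \<comment> \<open>The description picks a unique \<open>X\<close>, since \<open>indep\<close>
    makes the components disjoint.\<close>
  define \<tau> where "\<tau> Y =
    (if \<exists>X\<in>S. Y \<in> component c X then \<rho> (THE X. X \<in> S \<and> Y \<in> component c X) else \<sigma>)" for Y
  have in_comp: "\<tau> Y = \<rho> X" if "X \<in> S" "Y \<in> component c X" for X Y
  proof -
    have "(THE X. X \<in> S \<and> Y \<in> component c X) = X"
      using that component_disjoint indep by (intro the_equality) blast+
    with that show ?thesis unfolding \<tau>_def by auto
  qed
  have out: "\<tau> Y = \<sigma>" if "Y \<notin> (\<Union>X\<in>S. component c X)" for Y
    using that unfolding \<tau>_def by auto
  have "sat_atomic (glue \<tau>) a" if a: "a \<in> set c" for a
  proof (cases "\<exists>X\<in>S. vars_atomic a \<inter> component c X \<noteq> {}")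
    case True
    then obtain X where X: "X \<in> S" "vars_atomic a \<subseteq> component c X"
      using vars_atomic_subset_component[OF a] by blast
    then have "sat_atomic (glue \<tau>) a = sat_atomic (\<rho> X) a"
      using in_comp by (intro sat_atomic_cong) auto
    with \<rho>(2)[OF X(1)] a show ?thesis unfolding sat_def by blast
  next
    case False
    then have "sat_atomic (glue \<tau>) a = sat_atomic \<sigma> a"
      using out by (intro sat_atomic_cong) (simp, blast)
    with sat a show ?thesis unfolding sat_def by blast
  qed
  then have "sat (glue \<tau>) c" unfolding sat_def by blast
  moreover have "lookup (glue \<tau>) X = v X" if "X \<in> S" for X
    using in_comp[OF that, of X] \<rho>(1)[OF that] by (simp add: component_def)
  ultimately show thesis using that[of "glue \<tau>"] out by simp
qed

section \<open>Erasure of atoms and programs\<close>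

lemma nths_eq_iff_nth:
  assumes "length xs = length ys"
  shows "nths xs I = nths ys I \<longleftrightarrow> (\<forall>i<length xs. i \<in> I \<longrightarrow> xs ! i = ys ! i)"
  using assms
proof (induction xs ys arbitrary: I rule: list_induct2)
  case (Cons x xs y ys)
  then show ?case by (auto simp: nths_Cons All_less_Suc2)
qed simp

lemma pred_eval_atom [simp]: "pred (eval_atom \<sigma> A) = pred A"
  by (simp add: eval_atom_def)

lemma pred_erase_atom [simp]: "pred (erase_atom E A) = pred A"
  by (simp add: erase_atom_def)

lemma erase_eval_atom: "erase_atom E (eval_atom \<sigma> A) = eval_atom \<sigma> (erase_atom E A)"
  by (simp add: erase_atom_def eval_atom_def nths_map)

lemma erase_atom_Nil [simp]: "erase_atom E (Atom p []) = Atom p []"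
  by (simp add: erase_atom_def)

lemma prog_atoms_erase: "prog_atoms (erase_program E P) = erase_atom E ` prog_atoms P"
  by (auto simp: prog_atoms_def erase_program_def erase_clause_def)

lemma clp_program_erase:
  assumes "clp_program P"
  shows "clp_program (erase_program E P)"
proof -
  from assms obtain sig where "finite P"
    and sig: "\<forall>A\<in>prog_atoms P. map sort_of (args A) = sig (pred A)"
    unfolding clp_program_def by blast
  have "\<forall>A\<in>prog_atoms (erase_program E P).
      map sort_of (args A) = nths (sig (pred A)) {i. (pred A, Suc i) \<notin> E}"
    using sig by (auto simp: prog_atoms_erase erase_atom_def nths_map[symmetric])
  then have "\<exists>sig. \<forall>A\<in>prog_atoms (erase_program E P). map sort_of (args A) = sig (pred A)"
    by (rule exI[where x = "\<lambda>p. nths (sig p) {i. (p, Suc i) \<notin> E}"])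
  with \<open>finite P\<close> show ?thesis unfolding clp_program_def by (simp add: erase_program_def)
qed

text \<open>Erasure commutes with evaluation and keeps constraints, so the preimage of the erased
  program's least model is a model of \<open>P\<close>.\<close>

lemma erase_least_model:
  assumes "A \<in> least_model P"
  shows "erase_atom E A \<in> least_model (erase_program E P)"
proof -
  have "is_model {A. erase_atom E A \<in> least_model (erase_program E P)} P"
    using is_model_least_model[of "erase_program E P"]
    unfolding is_model_def erase_program_def erase_clause_def by (simp add: erase_eval_atom)
  from least_model_least[OF this] assms show ?thesis by blast
qed

section \<open>Safe erasures reflect derivability\<close>

text \<open>These are exactly the erasures at which \<open>cfar_step\<close> is stuck.\<close>

definition safe_erasure :: "'p program \<Rightarrow> 'p erasure \<Rightarrow> bool" where
  "safe_erasure P E \<longleftrightarrow> (\<forall>C\<in>P. \<forall>k. (pred (head C), k) \<in> E \<longrightarrow> safe_position E C k)"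

text \<open>The core step for one clause: any well-sorted preimage \<open>B\<close> of the erased
  head instance is itself a head instance, with the erased body unchanged.\<close>

lemma safe_erasure_reassign_head:
  fixes E :: "'p erasure"
  defines "erased C \<equiv> \<lambda>i. (pred (head C), Suc i) \<in> E"
  assumes safe: "\<And>k. (pred (head C), k) \<in> E \<Longrightarrow> safe_position E C k"
    and sat: "sat \<sigma> (cons C)"
    and p: "pred B = pred (head C)"
    and sorts: "map sort_of_val (args B) = map sort_of (args (head C))"
    and erase: "erase_atom E B = eval_atom \<sigma> (erase_atom E (head C))"
  obtains \<sigma>' where "sat \<sigma>' (cons C)" "eval_atom \<sigma>' (head C) = B"
    "\<And>A. A \<in> set (body C) \<Longrightarrow>
       eval_atom \<sigma>' (erase_atom E A) = eval_atom \<sigma> (erase_atom E A)"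
proof -
  define ts where "ts = args (head C)"
  \<comment> \<open>The erased head positions, counted from 0; \<open>erased\<close> hides the shift
    to the count from 1.\<close>
  define I where "I = {i. i < length ts \<and> erased C i}"
  have len: "length (args B) = length ts"
    using sorts unfolding ts_def by (metis length_map)
  have sort: "sort_of_val (args B ! i) = sort_of (ts ! i)" if "i < length ts" for i
    using arg_cong[OF sorts, of "\<lambda>xs. xs ! i"] that len by (simp add: ts_def)
  have kept: "args B ! i = eval_tm \<sigma> (ts ! i)" if "i < length ts" "i \<notin> I" for i
  proof -
    have "nths (args B) {i. \<not> erased C i} = nths (map (eval_tm \<sigma>) ts) {i. \<not> erased C i}"
      using erase p by (simp add: erase_atom_def eval_atom_def erased_def ts_def nths_map)
    with that len show ?thesis
      by (auto simp: nths_eq_iff_nth I_def)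
  qed
  let ?safe = "\<lambda>i X. ts ! i = var_tm X \<and> valid_forall_exists X (cons C) \<and>
        (\<forall>j<length ts. j \<noteq> i \<longrightarrow> X \<notin> vars_tm (ts ! j)) \<and>
        (\<forall>Y\<in>vars_atom (head C). Y \<noteq> X \<longrightarrow> \<not> constrained_to (cons C) X Y) \<and>
        (\<forall>A\<in>set (body C). \<forall>Y\<in>vars_atom (erase_atom E A).
           Y \<noteq> X \<and> \<not> constrained_to (cons C) X Y)"
  have "\<exists>X. ?safe i X" if "i \<in> I" for i
  proof -
    have "safe_position E C (Suc i)" using that safe by (simp add: I_def erased_def)
    then show ?thesis unfolding safe_position_def ts_def by simp
  qed
  then obtain x where "\<forall>i\<in>I. ?safe i (x i)" using bchoice[of I ?safe] by blast
  then have x: "\<And>i. i \<in> I \<Longrightarrow> ts ! i = var_tm (x i)"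
    and valid: "\<And>i. i \<in> I \<Longrightarrow> valid_forall_exists (x i) (cons C)"
    and x_other: "\<And>i j. i \<in> I \<Longrightarrow> j < length ts \<Longrightarrow> j \<noteq> i \<Longrightarrow> x i \<notin> vars_tm (ts ! j)"
    and x_head: "\<And>i Y. i \<in> I \<Longrightarrow> Y \<in> vars_atom (head C) \<Longrightarrow> Y \<noteq> x i \<Longrightarrow>
       \<not> constrained_to (cons C) (x i) Y"
    and x_body: "\<And>i A Y. i \<in> I \<Longrightarrow> A \<in> set (body C) \<Longrightarrow> Y \<in> vars_atom (erase_atom E A) \<Longrightarrow>
       Y \<notin> component (cons C) (x i)"
    unfolding component_def by blast+
  have I_less: "i < length ts" if "i \<in> I" for i using that by (simp add: I_def)
  have vars_head: "vars_tm (ts ! i) \<subseteq> vars_atom (head C)" if "i < length ts" for i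
    using nth_mem[OF that] unfolding vars_atom_def ts_def by blast
  have x_in_head: "x i \<in> vars_atom (head C)" if "i \<in> I" for i
    using vars_head[OF I_less[OF that]] x[OF that] by simp
  \<comment> \<open>An erased variable occurs in no other head argument, so each is assigned only
    one target value and \<open>v\<close> below is well defined.\<close>
  have inj: "inj_on x I"
  proof (rule inj_onI, rule ccontr)
    fix i j assume "i \<in> I" "j \<in> I" "x i = x j" "i \<noteq> j"
    then show False using x_other[of i j] x[of j] I_less[of j] by simp
  qed
  define v where "v X = args B ! the_inv_into I x X" for X
  have v: "v (x i) = args B ! i" if "i \<in> I" for i
    using that inj by (simp add: v_def the_inv_into_f_f)
  obtain \<sigma>' where \<sigma>': "sat \<sigma>' (cons C)" "\<And>X. X \<in> x ` I \<Longrightarrow> lookup \<sigma>' X = v X"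
    "\<And>Y. Y \<notin> (\<Union>X\<in>x ` I. component (cons C) X) \<Longrightarrow> lookup \<sigma>' Y = lookup \<sigma> Y"
  proof (rule sat_reassign_components[OF sat, of "x ` I" v])
    show "valid_forall_exists X (cons C)" if "X \<in> x ` I" for X
      using that valid by blast
    show "sort_of_val (v X) = sort_of (var_tm X)" if X: "X \<in> x ` I" for X
      using X v sort I_less x by (metis imageE)
    show "\<not> constrained_to (cons C) X Y" if "X \<in> x ` I" "Y \<in> x ` I" "X \<noteq> Y" for X Y
    proof -
      from that obtain i j where "i \<in> I" "X = x i" "j \<in> I" "Y = x j" by blast
      with \<open>X \<noteq> Y\<close> x_head[of i Y] x_in_head[of j] show ?thesis by simp
    qed
  qed (rule that)
  have "eval_tm \<sigma>' (ts ! i) = args B ! i" if i: "i < length ts" for i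
  proof (cases "i \<in> I")
    case True
    then show ?thesis using x v \<sigma>'(2) by simp
  next
    case False
    \<comment> \<open>Kept head arguments avoid all reassigned components, so they keep their values
      under \<sigma>.\<close>
    have "Y \<notin> component (cons C) (x j)" if "j \<in> I" "Y \<in> vars_tm (ts ! i)" for j Y
    proof -
      have "i \<noteq> j" using that(1) False by blast
      then have "Y \<noteq> x j" using x_other[OF that(1) i] that(2) by blast
      then show ?thesis
        using x_head[OF that(1), of Y] vars_head[OF i] that(2) by (auto simp: component_def)
    qed
    then have "eval_tm \<sigma>' (ts ! i) = eval_tm \<sigma> (ts ! i)"
      by (intro eval_tm_cong \<sigma>'(3)) blast
    with kept[OF i False] show ?thesis by simp
  qed
  then have "map (eval_tm \<sigma>') ts = args B"
    using len by (intro nth_equalityI) auto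
  then have "eval_atom \<sigma>' (head C) = B"
    using p by (cases B) (simp add: eval_atom_def ts_def)
  moreover have "eval_atom \<sigma>' (erase_atom E A) = eval_atom \<sigma> (erase_atom E A)"
    if "A \<in> set (body C)" for A
    using that x_body by (intro eval_atom_cong \<sigma>'(3)) blast
  ultimately show thesis using that \<sigma>'(1) by blast
qed

text \<open>Sortedness of \<open>A\<close> is essential: valuations respect sorts, so no ill-sorted
  ground atom is derivable from \<open>P\<close>, even when its erasure is derivable.\<close>

lemma safe_erasure_least_model:
  assumes sig: "\<forall>A\<in>prog_atoms P. map sort_of (args A) = sig (pred A)"
    and safe: "safe_erasure P E"
    and mem: "erase_atom E A \<in> least_model (erase_program E P)"
    and sorted: "map sort_of_val (args A) = sig (pred A)"
  shows "A \<in> least_model P"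
proof -
  \<comment> \<open>Quantifying over all well-sorted preimages makes the induction go through, since
    passing from \<sigma> to \<open>\<sigma>'\<close> may alter erased arguments of body
    atoms.\<close>
  define J where "J = {B. \<forall>A. erase_atom E A = B \<longrightarrow>
    map sort_of_val (args A) = sig (pred A) \<longrightarrow> A \<in> least_model P}"
  have "eval_atom \<sigma> (erase_atom E (head C)) \<in> J"
    if C: "C \<in> P" and sat: "sat \<sigma> (cons C)"
      and body: "\<forall>A\<in>set (body C). eval_atom \<sigma> (erase_atom E A) \<in> J" for C \<sigma>
    unfolding J_def
  proof (intro CollectI allI impI)
    fix B assume B: "erase_atom E B = eval_atom \<sigma> (erase_atom E (head C))"
      "map sort_of_val (args B) = sig (pred B)"
    have p: "pred B = pred (head C)" using arg_cong[OF B(1), of pred] by simp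
    have "head C \<in> prog_atoms P" using C by (auto simp: prog_atoms_def)
    with sig B(2) p have sorts: "map sort_of_val (args B) = map sort_of (args (head C))" by simp
    obtain \<sigma>' where \<sigma>': "sat \<sigma>' (cons C)" "eval_atom \<sigma>' (head C) = B"
      "\<And>A. A \<in> set (body C) \<Longrightarrow>
         eval_atom \<sigma>' (erase_atom E A) = eval_atom \<sigma> (erase_atom E A)"
      using safe_erasure_reassign_head[OF _ sat p sorts B(1)] safe C
      unfolding safe_erasure_def by metis
    have "eval_atom \<sigma>' A \<in> least_model P" if A: "A \<in> set (body C)" for A
    proof -
      have "A \<in> prog_atoms P" using A C by (auto simp: prog_atoms_def)
      with sig have "map sort_of_val (args (eval_atom \<sigma>' A)) = sig (pred (eval_atom \<sigma>' A))"
        by (simp add: eval_atom_def comp_def)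
      moreover have "erase_atom E (eval_atom \<sigma>' A) \<in> J"
        using body A \<sigma>'(3) by (simp add: erase_eval_atom)
      ultimately show ?thesis unfolding J_def by blast
    qed
    with \<sigma>'(1,2) C show "B \<in> least_model P"
      using is_model_least_model[of P] unfolding is_model_def by blast
  qed
  then have "is_model J (erase_program E P)"
    unfolding is_model_def erase_program_def erase_clause_def by simp
  from least_model_least[OF this] mem sorted show ?thesis unfolding J_def by blast
qed

section \<open>Termination and outputs of the algorithm\<close>

lemma finite_full_erasure:
  assumes "clp_program P"
  shows "finite (full_erasure P)"
proof -
  have "full_erasure P = (\<Union>A\<in>prog_atoms P. {pred A} \<times> {1..length (args A)})"
    by (auto simp: full_erasure_def)
  moreover have "finite (prog_atoms P)"
    using assms by (simp add: clp_program_def prog_atoms_def)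
  ultimately show ?thesis by simp
qed

lemma cfar_step_psubset: "cfar_step P E E' \<Longrightarrow> E' \<subset> E"
  by (auto elim: cfar_step.cases)

lemma cfar_terminates:
  assumes "clp_program P"
  shows "cfar_terminates P"
  unfolding cfar_terminates_def
proof (rule notI, elim exE conjE)
  fix f :: "nat \<Rightarrow> 'a erasure"
  assume f: "f 0 = full_erasure P" "\<forall>i. cfar_step P (f i) (f (Suc i))"
  have psub: "f (Suc i) \<subset> f i" for i
    using f(2) cfar_step_psubset[of P "f i" "f (Suc i)"] by simp
  have "finite (f i)" for i
  proof (induction i)
    case 0
    show ?case using f(1) finite_full_erasure[OF assms] by simp
  next
    case (Suc i)
    then show ?case using psub[of i] finite_subset[of "f (Suc i)" "f i"] by blast
  qed
  with psub have "(f (Suc i), f i) \<in> finite_psubset" for i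
    by (simp add: finite_psubset_def)
  then show False using wf_finite_psubset wf_iff_no_infinite_down_chain by blast
qed

text \<open>By induction along strict inclusion of finite sets: an erasure is either stuck or steps
  to a smaller one from which a stuck one is reachable.\<close>

lemma ex_cfar_output:
  assumes "clp_program P"
  shows "\<exists>E. cfar_output P E"
proof -
  have "\<exists>E'. (cfar_step P)\<^sup>*\<^sup>* E E' \<and> (\<nexists>E''. cfar_step P E' E'')" if "finite E" for E
    using that
  proof (induction rule: finite_psubset_induct)
    case (psubset E)
    then show ?case
      by (meson cfar_step_psubset converse_rtranclp_into_rtranclp rtranclp.rtrancl_refl)
  qed
  with finite_full_erasure[OF assms] show ?thesis unfolding cfar_output_def by blast
qed

lemma cfar_output_safe:
  assumes "cfar_output P E"
  shows "safe_erasure P E"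
  using assms unfolding cfar_output_def safe_erasure_def by (blast intro: cfar_step.remove)

theorem theorem2:
  fixes Prog :: "'p program" and unsafe :: 'p
  assumes "clp_program Prog"
    and "Atom unsafe [] \<in> prog_atoms Prog"
  shows "cfar_terminates Prog \<and>
    (\<exists>E. cfar_output Prog E) \<and>
    (\<forall>E. cfar_output Prog E \<longrightarrow>
       clp_program (erase_program E Prog) \<and>
       (Atom unsafe [] \<in> least_model Prog \<longleftrightarrow> Atom unsafe [] \<in> least_model (erase_program E Prog)))"
proof (intro conjI allI impI)
  show "cfar_terminates Prog" using assms(1) by (rule cfar_terminates)
  show "\<exists>E. cfar_output Prog E" using assms(1) by (rule ex_cfar_output)
  fix E assume E: "cfar_output Prog E"
  show "clp_program (erase_program E Prog)" using assms(1) by (rule clp_program_erase)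
  obtain sig where sig: "\<forall>A\<in>prog_atoms Prog. map sort_of (args A) = sig (pred A)"
    using assms(1) unfolding clp_program_def by blast
  \<comment> \<open>The occurrence of \<open>unsafe\<close> in the program fixes its signature,
    making \<open>Atom unsafe []\<close> a well-sorted preimage of itself.\<close>
  with assms(2) have "sig unsafe = []" by force
  then show "Atom unsafe [] \<in> least_model Prog \<longleftrightarrow>
      Atom unsafe [] \<in> least_model (erase_program E Prog)"
    using safe_erasure_least_model[OF sig cfar_output_safe[OF E], of "Atom unsafe []"]
      erase_least_model[of "Atom unsafe []" Prog E] by auto
qed

end
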